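(* Suppose either $3\le N\le 10$ and $p>1$, or $N\ge 11$ and $1<p<p_c$, where $p_c=p_c(N)$ is the Joseph–Lundgren exponent. If $a$ is a smooth divergence free vector field on $\mathbb{R}^N$ satisfying $|a(x)|\le \frac{C}{|x|+1}$ for all $x\in\mathbb{R}^N$ with $C>0$ sufficiently small (that is, there is $C_0=C_0(N,p)>0$ such that this holds whenever $0<C\le C_0$), then there is no positive stable solution of $$-\Delta u + a(x)\cdot\nabla u = u^p \quad\text{in } \mathbb{R}^N.$$
   Context: The Joseph–Lundgren exponent is $p_c=\frac{(N-2)^2-4N+8\sqrt{N-1}}{(N-2)(N-10)}$ for $N\ge 11$ and $p_c=\infty$ for $3\le N\le 10$. Stability: let $\Omega\subset\mathbb{R}^N$ be open and let $u$ be a nonnegative smooth solution of $-\Delta u + a(x)\cdot\nabla u = u^p$ in $\Omega$. Then $u$ is called a stable solution in $\Omega$ if there is a smooth positive function $E$ on $\Omega$ with $-\Delta E + a(x)\cdot\nabla E \ge p u^{p-1}E$ in $\Omega$. Here $\Omega=\mathbb{R}^N$. *)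

theory Defs
  imports "HOL-Analysis.Analysis" "HOL-Library.Extended_Real"
begin

definition partial_deriv :: "'n::finite \<Rightarrow> (real^'n \<Rightarrow> 'b::real_normed_vector) \<Rightarrow> real^'n \<Rightarrow> 'b" where
  "partial_deriv i f x = frechet_derivative f (at x) (axis i 1)"

(* Intended for open S only: differentiable_on is taken within S, partial_deriv
   in the whole space. On open S this is the usual class C^k. *)
fun Ck_on :: "nat \<Rightarrow> (real^'n::finite) set \<Rightarrow> (real^'n \<Rightarrow> 'b::real_normed_vector) \<Rightarrow> bool" where
  "Ck_on 0 S f \<longleftrightarrow> continuous_on S f"
| "Ck_on (Suc k) S f \<longleftrightarrow> f differentiable_on S \<and> (\<forall>i. Ck_on k S (partial_deriv i f))"

definition smooth_on :: "(real^'n::finite) set \<Rightarrow> (real^'n \<Rightarrow> 'b::real_normed_vector) \<Rightarrow> bool" where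
  "smooth_on S f \<longleftrightarrow> (\<forall>k. Ck_on k S f)"

definition gradient :: "(real^'n::finite \<Rightarrow> real) \<Rightarrow> real^'n \<Rightarrow> real^'n" where
  "gradient f x = (\<chi> i. partial_deriv i f x)"

definition laplacian :: "(real^'n::finite \<Rightarrow> real) \<Rightarrow> real^'n \<Rightarrow> real" where
  "laplacian f x = (\<Sum>i\<in>UNIV. partial_deriv i (partial_deriv i f) x)"

definition divergence :: "(real^'n::finite \<Rightarrow> real^'n) \<Rightarrow> real^'n \<Rightarrow> real" where
  "divergence a x = (\<Sum>i\<in>UNIV. partial_deriv i (\<lambda>y. a y $ i) x)"

definition advection_op ::
    "(real^'n::finite \<Rightarrow> real^'n) \<Rightarrow> (real^'n \<Rightarrow> real) \<Rightarrow> real^'n \<Rightarrow> real" where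
  "advection_op a f x = - laplacian f x + a x \<bullet> gradient f x"

definition nonneg_smooth_solution ::
    "(real^'n::finite \<Rightarrow> real^'n) \<Rightarrow> real \<Rightarrow> (real^'n) set \<Rightarrow> (real^'n \<Rightarrow> real) \<Rightarrow> bool" where
  "nonneg_smooth_solution a p \<Omega> u \<longleftrightarrow>
     smooth_on \<Omega> u \<and> (\<forall>x\<in>\<Omega>. 0 \<le> u x) \<and> (\<forall>x\<in>\<Omega>. advection_op a u x = u x powr p)"

definition stable_solution ::
    "(real^'n::finite \<Rightarrow> real^'n) \<Rightarrow> real \<Rightarrow> (real^'n) set \<Rightarrow> (real^'n \<Rightarrow> real) \<Rightarrow> bool" where
  "stable_solution a p \<Omega> u \<longleftrightarrow>
     open \<Omega> \<and> nonneg_smooth_solution a p \<Omega> u \<and>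
     (\<exists>E. smooth_on \<Omega> E \<and> (\<forall>x\<in>\<Omega>. 0 < E x) \<and>
          (\<forall>x\<in>\<Omega>. advection_op a E x \<ge> p * u x powr (p - 1) * E x))"

(* Only N \<ge> 3 is meaningful; the value for smaller N is arbitrary. *)
definition joseph_lundgren_exponent :: "nat \<Rightarrow> ereal" where
  "joseph_lundgren_exponent N =
     (if 11 \<le> N
      then ereal (((real N - 2)\<^sup>2 - 4 * real N + 8 * sqrt (real N - 1))
                  / ((real N - 2) * (real N - 10)))
      else \<infinity>)"

end

theory Submission
  imports Defs
begin

text \<open>
  The proof is Farina's argument for stable solutions, arranged so that it tolerates a small advection.
  Let \<open>\<theta>\<close> be a cutoff and \<open>\<psi> = u\<^sup>s \<theta>\<close>. Testing the supersolution property of \<open>E\<close> with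
  \<open>\<psi>\<^sup>2 / E\<close> and completing a square gives
  \<open>p \<integral> u\<^sup>p\<^sup>-\<^sup>1 \<psi>\<^sup>2 \<le> \<integral> |\<nabla>\<psi> + \<psi> a / 2|\<^sup>2\<close>.
  The drift has the size \<open>C / (1 + |x|)\<close>, and Hardy's inequality bounds the integral of
  \<open>\<psi>\<^sup>2 / (1 + |x|\<^sup>2)\<close> by that of \<open>|\<nabla>\<psi>|\<^sup>2\<close>. Thus a small \<open>C\<close> only changes the constants
  slightly. Testing the equation of \<open>u\<close> with \<open>u\<^sup>2\<^sup>s\<^sup>-\<^sup>1 \<theta>\<^sup>2\<close> controls the main part of
  \<open>\<integral> |\<nabla>\<psi>|\<^sup>2\<close>, up to small errors, by \<open>s\<^sup>2 / (2 s - 1)\<close> times the same integral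
  \<open>\<integral> u\<^sup>p\<^sup>-\<^sup>1 \<psi>\<^sup>2\<close>. If \<open>s\<^sup>2 < p (2 s - 1)\<close>, this integral is therefore bounded by a multiple of
  \<open>\<integral> u\<^sup>2\<^sup>s |\<nabla>\<theta>|\<^sup>2\<close>.

  Young's inequality, after absorbing a part on the left, turns the last bound into a multiple of \<open>R\<close> to the power
  \<open>N - 2 - 4 s / (p - 1)\<close> for a cutoff at scale \<open>R\<close>. When the exponent is negative,
  \<open>R \<rightarrow> \<infinity>\<close> forces the integral over the unit ball to vanish, which is impossible for a positive
  \<open>u\<close>. The admissible \<open>s\<close> reach up to \<open>p + sqrt (p (p - 1))\<close>, and an admissible \<open>s\<close> with
  negative exponent exists exactly below the Joseph--Lundgren exponent
  (\<open>exists_farina_exponent\<close>).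

  Each test function argument is an integration of the divergence of a compactly supported
  field. All of them are combined into one pointwise inequality (\<open>farina_pointwise\<close> for the algebra,
  \<open>stable_energy_estimate\<close> for the calculus) in which those divergences appear explicitly, so the only
  integral theorem used is that they integrate to zero (\<open>integral_derivative_along_zero\<close>).
  The admissible size of the drift, \<open>\<epsilon> / 2\<close>, depends only on \<open>N\<close> and \<open>p\<close> because
  \<open>s\<close> and \<open>\<epsilon>\<close> are chosen first (\<open>exists_perturbation\<close>).
\<close>

section \<open>Directional derivatives and their integrals\<close>

text \<open>
  A derivative in one fixed direction, with the function and the derivative continuous on the whole
  space. Divergences only involve one such derivative for each component, and one-variable calculus
  along lines keeps the product, power and quotient rules elementary.
\<close>
definition C1_along :: "'a::real_normed_vector \<Rightarrow> ('a \<Rightarrow> real) \<Rightarrow> ('a \<Rightarrow> real) \<Rightarrow> bool" where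
  "C1_along e f f' \<longleftrightarrow> continuous_on UNIV f \<and> continuous_on UNIV f' \<and>
     (\<forall>x. ((\<lambda>t. f (x + t *\<^sub>R e)) has_real_derivative f' x) (at 0))"

text \<open>
  The derivative at the start of a line is available at every base point, so a shift of the
  base point gives it along the whole line, as the mean value theorem requires.
\<close>
lemma C1_along_line:
  assumes "C1_along e f f'"
  shows "((\<lambda>t. f (x + t *\<^sub>R e)) has_real_derivative f' (x + t *\<^sub>R e)) (at t)"
proof -
  have "((\<lambda>h. f ((x + t *\<^sub>R e) + h *\<^sub>R e)) has_real_derivative f' (x + t *\<^sub>R e)) (at 0)"
    using assms by (auto simp: C1_along_def)
  then have "((\<lambda>h. f (x + (t + h) *\<^sub>R e)) has_real_derivative f' (x + t *\<^sub>R e)) (at 0)"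
    by (simp add: algebra_simps)
  then show ?thesis
    using DERIV_at_within_shift[of "\<lambda>t. f (x + t *\<^sub>R e)" "f' (x + t *\<^sub>R e)" t 0 UNIV]
    by (simp add: add.commute)
qed

lemma C1_along_mult:
  assumes "C1_along e f f'" "C1_along e g g'"
  shows "C1_along e (\<lambda>x. f x * g x) (\<lambda>x. f' x * g x + f x * g' x)"
  using assms unfolding C1_along_def
  by (auto intro!: continuous_intros derivative_eq_intros simp: algebra_simps)

lemma C1_along_add:
  assumes "C1_along e f f'" "C1_along e g g'"
  shows "C1_along e (\<lambda>x. f x + g x) (\<lambda>x. f' x + g' x)"
  using assms unfolding C1_along_def
  by (auto intro!: continuous_intros derivative_eq_intros)

lemma C1_along_cmult:
  assumes "C1_along e f f'"
  shows "C1_along e (\<lambda>x. c * f x) (\<lambda>x. c * f' x)"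
  using assms unfolding C1_along_def
  by (auto intro!: continuous_intros derivative_eq_intros)

lemma C1_along_powr:
  assumes "C1_along e f f'" "\<And>x. 0 < f x"
  shows "C1_along e (\<lambda>x. f x powr r) (\<lambda>x. r * f x powr (r - 1) * f' x)"
proof -
  have *: "f x \<noteq> 0" for x using assms(2)[of x] by simp
  show ?thesis
    using assms(1) * assms(2) unfolding C1_along_def
    by (auto intro!: continuous_intros derivative_eq_intros)
qed

lemma C1_along_inverse:
  assumes "C1_along e f f'" "\<And>x. 0 < f x"
  shows "C1_along e (\<lambda>x. inverse (f x)) (\<lambda>x. - f' x * (inverse (f x))\<^sup>2)"
proof -
  have *: "f x \<noteq> 0" for x using assms(2)[of x] by simp
  show ?thesis
    using assms(1) * assms(2) unfolding C1_along_def
    by (auto intro!: continuous_intros derivative_eq_intros simp: power2_eq_square)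
qed

text \<open>
  At the kink the difference quotient of the truncated power is a lower truncated power, which is
  continuous and vanishes there; this is why an exponent of at least two is taken.
\<close>
lemma DERIV_max_zero_power:
  fixes t :: real
  shows "((\<lambda>t::real. max 0 t ^ Suc (Suc k)) has_real_derivative real (Suc (Suc k)) * max 0 t ^ Suc k) (at t)"
proof (cases t "0::real" rule: linorder_cases)
  case less
  have "((\<lambda>t::real. 0::real) has_real_derivative 0) (at t)" by simp
  then have "((\<lambda>t::real. max 0 t ^ Suc (Suc k)) has_real_derivative 0) (at t)"
    by (rule has_field_derivative_transform_within_open[where S="{..<0}"]) (use less in auto)
  with less show ?thesis by simp
next
  case equal
  have "\<exists>g. (\<forall>z. max 0 z ^ Suc (Suc k) - max 0 (0::real) ^ Suc (Suc k) = g z * (z - 0)) \<and> isCont g 0 \<and> g 0 = 0"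
  proof (intro exI[of _ "\<lambda>z. max 0 z ^ Suc k"] conjI allI)
    show "isCont (\<lambda>z::real. max 0 z ^ Suc k) 0" by (intro continuous_intros)
  qed (auto simp: max_def)
  then show ?thesis using equal by (simp add: CARAT_DERIV)
next
  case greater
  have "((\<lambda>t::real. t ^ Suc (Suc k)) has_real_derivative real (Suc (Suc k)) * t ^ Suc k) (at t)"
    using DERIV_pow[of "Suc (Suc k)" t] by simp
  then have "((\<lambda>t::real. max 0 t ^ Suc (Suc k)) has_real_derivative real (Suc (Suc k)) * t ^ Suc k) (at t)"
    by (rule has_field_derivative_transform_within_open[where S="{0<..}"]) (use greater in auto)
  with greater show ?thesis by simp
qed

lemma C1_along_max_zero_power:
  assumes "C1_along e f f'" 
  shows "C1_along e (\<lambda>x. max 0 (f x) ^ Suc (Suc k)) (\<lambda>x. real (Suc (Suc k)) * max 0 (f x) ^ Suc k * f' x)"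
proof -
  have "((\<lambda>t. max 0 (f (x + t *\<^sub>R e)) ^ Suc (Suc k)) has_real_derivative
          real (Suc (Suc k)) * max 0 (f x) ^ Suc k * f' x) (at 0)" for x
  proof -
    have "((\<lambda>t. f (x + t *\<^sub>R e)) has_real_derivative f' x) (at 0)"
      using assms by (simp add: C1_along_def)
    from DERIV_chain2[OF _ this, of "\<lambda>t. max 0 t ^ Suc (Suc k)"] DERIV_max_zero_power[of k "f x"]
    show ?thesis by simp
  qed
  with assms show ?thesis unfolding C1_along_def
    by (auto intro!: continuous_intros simp del: power_Suc)
qed

lemma C1_along_norm_sq:
  fixes e :: "'a::real_inner"
  shows "C1_along e (\<lambda>x. x \<bullet> x) (\<lambda>x. 2 * (x \<bullet> e))"
  unfolding C1_along_def
  by (auto intro!: continuous_intros derivative_eq_intros 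
     simp: inner_add_left inner_add_right inner_commute has_real_derivative_iff_has_vector_derivative has_vector_derivative_def)

lemma C1_along_inner:
  fixes e :: "'a::real_inner"
  shows "C1_along e (\<lambda>x. x \<bullet> v) (\<lambda>x. e \<bullet> v)"
  unfolding C1_along_def
  by (auto intro!: continuous_intros derivative_eq_intros simp: inner_add_left)

lemma C1_along_const: "C1_along e (\<lambda>x. c) (\<lambda>x. 0)"
  by (simp add: C1_along_def)

text \<open>
  Translation invariance of Lebesgue measure makes the integral of every difference quotient of
  \<open>f\<close> vanish. The quotients with steps at most 1 are supported in one common ball and, by
  the mean value theorem, bounded by the maximum of \<open>f'\<close>, so dominated convergence passes to the
  derivative. Summed over the coordinate directions, this is the divergence theorem for compactly
  supported fields.
\<close>
lemma integral_derivative_along_zero: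
  fixes e :: "'a::euclidean_space"
  assumes f: "C1_along e f f'" and supp: "\<And>x. R < norm x \<Longrightarrow> f x = 0"
  shows "integrable lborel f'" and "integral\<^sup>L lborel f' = 0"
proof -
  have cf: "continuous_on UNIV f" and cf': "continuous_on UNIV f'"
    using f by (auto simp: C1_along_def)
  \<comment> \<open>Outside the closed ball, \<open>f\<close> vanishes on a whole neighbourhood.\<close>
  have supp': "f' x = 0" if "R < norm x" for x
  proof -
    have "((\<lambda>t. f (x + t *\<^sub>R e)) has_real_derivative f' x) (at 0)"
      using f by (simp add: C1_along_def)
    moreover have "((\<lambda>t. f (x + t *\<^sub>R e)) has_real_derivative 0) (at 0)"
    proof (rule has_field_derivative_transform_within_open[where f = "\<lambda>_. 0" and S = "{t. R < norm (x + t *\<^sub>R e)}"])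
      show "open {t. R < norm (x + t *\<^sub>R e)}"
        by (intro open_Collect_less continuous_intros)
    qed (use that supp in auto)
    ultimately show ?thesis by (rule DERIV_unique)
  qed
  have int_of_supp: "integrable lborel g"
    if "continuous_on UNIV g" "\<And>x. R < norm x \<Longrightarrow> g x = 0" for g :: "'a \<Rightarrow> real"
  proof -
    have "set_integrable lborel (cball 0 R) g"
      unfolding set_integrable_def
      by (rule borel_integrable_compact) (use that(1) in \<open>auto intro: continuous_on_subset\<close>)
    moreover have "(\<lambda>x. indicator (cball 0 R) x *\<^sub>R g x) = g"
      using that(2) by (auto simp: indicator_def fun_eq_iff not_le)
    ultimately show ?thesis by (simp add: set_integrable_def)
  qed
  have intf: "integrable lborel f" using int_of_supp cf supp by blast
  show "integrable lborel f'" using int_of_supp cf' supp' by blast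
  have "bounded (f' ` cball 0 R)"
    by (intro compact_imp_bounded compact_continuous_image continuous_on_subset[OF cf']) auto
  then obtain M where M0: "0 < M" and M: "\<And>x. x \<in> cball 0 R \<Longrightarrow> norm (f' x) \<le> M"
    unfolding bounded_pos by auto
  have M': "\<bar>f' x\<bar> \<le> M" for x
    using M[of x] supp'[of x] M0 by (cases "R < norm x") auto
  define h where "h n = 1 / real (Suc n)" for n
  have h: "0 < h n" "h n \<le> 1" for n by (auto simp: h_def field_simps)
  have h0: "h \<longlonglongrightarrow> 0" unfolding h_def by (rule LIMSEQ_Suc) (rule lim_1_over_n)
  define q where "q n x = (f (x + h n *\<^sub>R e) - f x) / h n" for n x
  have trans: "integrable lborel (\<lambda>x. f (x + v))" "(\<integral>x. f (x + v) \<partial>lborel) = (\<integral>x. f x \<partial>lborel)" for v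
  proof -
    have "integrable (distr lborel borel ((+) v)) f"
      using intf by (simp add: lborel_distr_plus)
    then show "integrable lborel (\<lambda>x. f (x + v))"
      by (subst (asm) integrable_distr_eq) (use cf in \<open>auto simp: add.commute intro: borel_measurable_continuous_onI\<close>)
    have "(\<integral>x. f x \<partial>lborel) = (\<integral>x. f x \<partial>(distr lborel borel ((+) v)))"
      by (simp add: lborel_distr_plus)
    also have "\<dots> = (\<integral>x. f (x + v) \<partial>lborel)"
      by (subst integral_distr) (use cf in \<open>auto simp: add.commute intro: borel_measurable_continuous_onI\<close>)
    finally show "(\<integral>x. f (x + v) \<partial>lborel) = (\<integral>x. f x \<partial>lborel)" by simp
  qed
  have qint: "(\<integral>x. q n x \<partial>lborel) = 0" for n
    unfolding q_def using trans intf by simp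
  have qbound: "norm (q n x) \<le> indicator (cball 0 (R + norm e)) x * M" for n x
  proof (cases "norm x \<le> R + norm e")
    case True
    obtain z where "f (x + h n *\<^sub>R e) - f (x + 0 *\<^sub>R e) = (h n - 0) * f' (x + z *\<^sub>R e)"
      using MVT2[of 0 "h n" "\<lambda>t. f (x + t *\<^sub>R e)" "\<lambda>t. f' (x + t *\<^sub>R e)"] h(1)[of n] C1_along_line[OF f]
      by blast
    then have "q n x = f' (x + z *\<^sub>R e)" using h(1)[of n] by (simp add: q_def)
    then show ?thesis using M' True by simp
  next
    case False
    have "norm x \<le> norm (x + h n *\<^sub>R e) + norm (h n *\<^sub>R e)" 
      by (metis add_diff_cancel_right' norm_triangle_ineq4)
    moreover have "norm (h n *\<^sub>R e) \<le> norm e" using h[of n] by (simp add: mult_left_le_one_le)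
    ultimately have "R < norm (x + h n *\<^sub>R e)" using False by linarith
    moreover have "R < norm x" using False norm_ge_zero[of e] by linarith
    ultimately show ?thesis using supp M0 by (simp add: q_def)
  qed
  have qlim: "(\<lambda>n. q n x) \<longlonglongrightarrow> f' x" for x
  proof -
    have "((\<lambda>t. (f (x + t *\<^sub>R e) - f x) / t) \<longlongrightarrow> f' x) (at 0)"
      using f by (simp add: C1_along_def has_field_derivative_iff)
    moreover have "filterlim h (at 0) sequentially"
      using h0 h(1) by (auto simp: filterlim_at intro!: always_eventually less_imp_neq[THEN not_sym])
    ultimately show ?thesis unfolding q_def by (rule filterlim_compose)
  qed
  have "(\<lambda>n. \<integral>x. q n x \<partial>lborel) \<longlonglongrightarrow> (\<integral>x. f' x \<partial>lborel)"
  proof (rule integral_dominated_convergence[where w = "\<lambda>x. indicator (cball 0 (R + norm e)) x * M"])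
    show "f' \<in> borel_measurable lborel"
      using cf' by (auto intro: borel_measurable_continuous_onI)
    have "continuous_on UNIV (q n)" for n
      unfolding q_def using h(1)[of n]
      by (intro continuous_intros continuous_on_compose2[OF cf]) auto
    then show "q n \<in> borel_measurable lborel" for n
      by (auto intro: borel_measurable_continuous_onI)
    show "integrable lborel (\<lambda>x. indicator (cball (0::'a) (R + norm e)) x * M)"
      using emeasure_bounded_finite[OF bounded_cball, of "0::'a" "R + norm e"]
      by (intro integrable_mult_left integrable_real_indicator) auto
  qed (use qlim qbound in auto)
  then show "integral\<^sup>L lborel f' = 0"
    by (simp add: qint LIMSEQ_const_iff)
qed

section \<open>Farina's inequality at a point\<close>

lemma weighted_square_bound:
  fixes a b t :: real
  assumes "0 < t"
  shows "2 * a * b \<le> t * a\<^sup>2 + b\<^sup>2 / t"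
proof -
  have "0 \<le> (t * a - b)\<^sup>2 / t" using assms by simp
  also have "\<dots> = t * a\<^sup>2 + b\<^sup>2 / t - 2 * a * b"
    using assms by (simp add: field_simps power2_eq_square)
  finally show ?thesis by simp
qed

lemma weighted_inner_bound:
  fixes v w :: "'a::real_inner"
  assumes "0 < t"
  shows "2 * (v \<bullet> w) \<le> t * (v \<bullet> v) + (w \<bullet> w) / t"
proof -
  have "2 * (v \<bullet> w) \<le> 2 * norm v * norm w" using norm_cauchy_schwarz[of v w] by simp
  also have "\<dots> \<le> t * (norm v)\<^sup>2 + (norm w)\<^sup>2 / t" by (rule weighted_square_bound[OF assms])
  finally show ?thesis by (simp add: power2_norm_eq_inner)
qed

text \<open>
  The algebra of Farina's argument at one point. In the application \<open>\<psi> = u\<^sup>s \<theta>\<close>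
  with a cutoff \<open>\<theta>\<close>, and
  \<open>P = \<nabla>\<psi>\<close>, \<open>Q = u\<^sup>s\<^sup>-\<^sup>1 \<theta> \<nabla>u\<close>, \<open>h = u\<^sup>s \<nabla>\<theta>\<close>, \<open>F = \<nabla>E / E\<close>, \<open>X = w x\<close> with
  \<open>w = 1 / (1 + x \<bullet> x)\<close>, and \<open>B = u\<^sup>p\<^sup>-\<^sup>1 \<psi>\<^sup>2\<close>. The numbers \<open>d1\<close>, \<open>d2\<close>, \<open>d3\<close> are the divergences of
  \<open>\<psi>\<^sup>2 F\<close>, \<open>\<theta>\<^sup>2 u\<^sup>2\<^sup>s\<^sup>-\<^sup>1 \<nabla>u\<close> and \<open>\<psi>\<^sup>2 X\<close>; they disappear on integration. What remains then reads:
  \<open>p B\<close> is at most about \<open>s\<^sup>2 (Q \<bullet> Q)\<close> by stability, \<open>(2 s - 1) (Q \<bullet> Q)\<close> is at most about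
  \<open>B\<close> by the equation, and \<open>\<psi>\<^sup>2 (a \<bullet> a)\<close> is small against \<open>P \<bullet> P\<close> by Hardy's inequality.
\<close>
lemma farina_pointwise:
  fixes P F X a Q h :: "'a::real_inner"
  assumes eps: "0 < \<epsilon>" "\<epsilon> \<le> 1" and C: "0 \<le> C" "C \<le> \<epsilon> / 2"
    and P: "P = s *\<^sub>R Q + h"
    and a: "(norm a)\<^sup>2 \<le> C\<^sup>2 * w" and X: "X \<bullet> X \<le> w"
    and \<mu>: "\<mu> = 2 * s - 1 - 2 * \<epsilon> - \<epsilon> * (1 + \<epsilon>) * s\<^sup>2" "0 < \<mu>"
    and \<nu>: "\<nu> = (1 + 2 * \<epsilon>) * (1 + \<epsilon>) * s\<^sup>2"
    and K: "K = \<mu> * (1 + 2 * \<epsilon>) * (1 + 1 / \<epsilon>) + \<nu> * (1 / \<epsilon> + 1 + \<epsilon>)"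
    and d1: "d1 \<le> 2 * \<psi> * (P \<bullet> F) - \<psi>\<^sup>2 * (F \<bullet> F) + \<psi>\<^sup>2 * (a \<bullet> F) - p * B"
    and d2: "d2 = (2 * s - 1) * (Q \<bullet> Q) + 2 * (Q \<bullet> h) + \<psi> * (a \<bullet> Q) - B"
    and d3: "d3 \<ge> 2 * \<psi> * (P \<bullet> X) + \<psi>\<^sup>2 * w"
  shows "(\<mu> * p - \<nu>) * B \<le> - \<mu> * d1 + \<nu> * d2 + \<epsilon> / 2 * (\<mu> + \<nu>) * d3 + K * (h \<bullet> h)"
proof -
  define H where "H = \<psi>\<^sup>2 * w"
  have w0: "0 \<le> w" using X inner_ge_zero[of X] by linarith
  have H0: "0 \<le> H" using w0 by (simp add: H_def)
  \<comment> \<open>Hardy: \<open>d3\<close> is the divergence of \<open>\<psi>\<^sup>2 X\<close>, and half of \<open>H\<close> absorbs the cross term.\<close>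
  have hardy: "H \<le> 2 * d3 + 4 * (P \<bullet> P)"
  proof -
    have "- (2 * (P \<bullet> (\<psi> *\<^sub>R X))) \<le> 2 * (P \<bullet> P) + ((\<psi> *\<^sub>R X) \<bullet> (\<psi> *\<^sub>R X)) / 2"
      using weighted_inner_bound[of 2 "- P" "\<psi> *\<^sub>R X"] by simp
    moreover have "(\<psi> *\<^sub>R X) \<bullet> (\<psi> *\<^sub>R X) \<le> H"
      using mult_left_mono[OF X, of "\<psi>\<^sup>2"] by (simp add: H_def power2_eq_square mult.assoc)
    ultimately show ?thesis using d3 by (simp add: H_def algebra_simps)
  qed
  have aH: "(\<psi> *\<^sub>R a) \<bullet> (\<psi> *\<^sub>R a) \<le> C\<^sup>2 * H"
    using mult_left_mono[OF a, of "\<psi>\<^sup>2"] 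
    unfolding H_def power2_norm_eq_inner by (simp add: power2_eq_square algebra_simps)
  have C2: "C\<^sup>2 \<le> \<epsilon>\<^sup>2 / 4" using power_mono[OF C(2,1), of 2] by (simp add: power_divide)
  have aH': "(\<psi> *\<^sub>R a) \<bullet> (\<psi> *\<^sub>R a) \<le> \<epsilon>\<^sup>2 / 4 * H"
    using aH mult_right_mono[OF C2 H0] by linarith
  have epsH: "\<epsilon> / 4 * H \<le> \<epsilon> / 2 * d3 + \<epsilon> * (P \<bullet> P)"
    using mult_left_mono[OF hardy, of "\<epsilon> / 4"] eps by (simp add: algebra_simps)
  have PP: "P \<bullet> P \<le> (1 + \<epsilon>) * s\<^sup>2 * (Q \<bullet> Q) + (1 + 1 / \<epsilon>) * (h \<bullet> h)"
  proof -
    have "2 * ((s *\<^sub>R Q) \<bullet> h) \<le> \<epsilon> * ((s *\<^sub>R Q) \<bullet> (s *\<^sub>R Q)) + (h \<bullet> h) / \<epsilon>"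
      by (rule weighted_inner_bound[OF eps(1)])
    then show ?thesis 
      by (simp add: P inner_add_left inner_add_right inner_commute power2_eq_square algebra_simps)
  qed
  have stab: "p * B \<le> - d1 + \<epsilon> / 2 * d3 + (1 + 2 * \<epsilon>) * (P \<bullet> P)"
  proof -
    \<comment> \<open>Completing the square in \<open>F\<close> removes the unknown function \<open>E\<close>.\<close>
    define G where "G = P + (\<psi> / 2) *\<^sub>R a"
    have "0 \<le> (G - \<psi> *\<^sub>R F) \<bullet> (G - \<psi> *\<^sub>R F)" by simp
    then have "2 * \<psi> * (P \<bullet> F) - \<psi>\<^sup>2 * (F \<bullet> F) + \<psi>\<^sup>2 * (a \<bullet> F) \<le> G \<bullet> G"
      by (simp add: G_def inner_add_left inner_add_right inner_diff_left inner_diff_right inner_commute power2_eq_square algebra_simps)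
    moreover have "G \<bullet> G \<le> (1 + \<epsilon>) * (P \<bullet> P) + (1 + 1 / \<epsilon>) * (((\<psi> *\<^sub>R a) \<bullet> (\<psi> *\<^sub>R a)) / 4)"
      using weighted_inner_bound[OF eps(1), of P "(\<psi> / 2) *\<^sub>R a"]
      by (simp add: G_def inner_add_left inner_add_right inner_commute algebra_simps add_divide_distrib)
    moreover have "(1 + 1 / \<epsilon>) * (((\<psi> *\<^sub>R a) \<bullet> (\<psi> *\<^sub>R a)) / 4) \<le> \<epsilon> / 4 * H"
    proof -
      have "(1 + 1 / \<epsilon>) * (((\<psi> *\<^sub>R a) \<bullet> (\<psi> *\<^sub>R a)) / 4) \<le> (1 + 1 / \<epsilon>) * ((\<epsilon>\<^sup>2 / 4 * H) / 4)"
        using aH' eps by (intro mult_left_mono divide_right_mono) auto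
      also have "\<dots> = (\<epsilon> + 1) * \<epsilon> * H / 16"
        using eps by (simp add: field_simps power2_eq_square)
      also have "\<dots> \<le> 4 * \<epsilon> * H / 16"
        using eps H0 by (intro divide_right_mono mult_right_mono) auto
      also have "\<dots> = \<epsilon> / 4 * H" by simp
      finally show ?thesis .
    qed
    ultimately have "p * B \<le> - d1 + (1 + \<epsilon>) * (P \<bullet> P) + \<epsilon> / 4 * H" using d1 by linarith
    with epsH show ?thesis by (simp add: algebra_simps)
  qed
  have energy: "\<mu> * (Q \<bullet> Q) \<le> d2 + \<epsilon> / 2 * d3 + B + (1 / \<epsilon> + 1 + \<epsilon>) * (h \<bullet> h)"
  proof -
    have 1: "- (2 * (Q \<bullet> h)) \<le> \<epsilon> * (Q \<bullet> Q) + (h \<bullet> h) / \<epsilon>"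
      using weighted_inner_bound[OF eps(1), of "- Q" h] by simp
    have 2: "- (2 * (Q \<bullet> (\<psi> *\<^sub>R a))) \<le> 2 * \<epsilon> * (Q \<bullet> Q) + ((\<psi> *\<^sub>R a) \<bullet> (\<psi> *\<^sub>R a)) / (2 * \<epsilon>)"
      using weighted_inner_bound[of "2 * \<epsilon>" "- Q" "\<psi> *\<^sub>R a"] eps by simp
    have "((\<psi> *\<^sub>R a) \<bullet> (\<psi> *\<^sub>R a)) / (2 * \<epsilon>) \<le> (\<epsilon>\<^sup>2 / 4 * H) / (2 * \<epsilon>)"
      using aH' eps by (intro divide_right_mono) auto
    also have "\<dots> = \<epsilon> / 8 * H" using eps by (simp add: field_simps power2_eq_square)
    also have "\<dots> \<le> \<epsilon> / 2 * H" using eps H0 by (intro mult_right_mono) auto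
    finally have 3: "((\<psi> *\<^sub>R a) \<bullet> (\<psi> *\<^sub>R a)) / (2 * \<epsilon>) \<le> \<epsilon> / 2 * H" .
    have 4: "- (\<psi> * (a \<bullet> Q)) \<le> \<epsilon> * (Q \<bullet> Q) + \<epsilon> / 4 * H"
    proof -
      have "- (2 * (\<psi> * (a \<bullet> Q))) \<le> 2 * \<epsilon> * (Q \<bullet> Q) + \<epsilon> / 2 * H"
        using 2 3 by (simp add: inner_commute)
      then show ?thesis by simp
    qed
    have "(2 * s - 1) * (Q \<bullet> Q) \<le> d2 + B + 2 * \<epsilon> * (Q \<bullet> Q) + (h \<bullet> h) / \<epsilon> + \<epsilon> / 4 * H"
      using 1 4 d2 by linarith
    with epsH mult_left_mono[OF PP, of \<epsilon>] eps show ?thesis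
      unfolding \<mu>(1) by (simp add: algebra_simps)
  qed
  have "p * B \<le> - d1 + \<epsilon> / 2 * d3 + \<nu> * (Q \<bullet> Q) + (1 + 2 * \<epsilon>) * (1 + 1 / \<epsilon>) * (h \<bullet> h)"
    using stab mult_left_mono[OF PP, of "1 + 2 * \<epsilon>"] eps unfolding \<nu> by (simp add: algebra_simps)
  from mult_left_mono[OF this, of \<mu>] \<mu>(2)
  have *: "\<mu> * (p * B) \<le> \<mu> * (- d1 + \<epsilon> / 2 * d3 + \<nu> * (Q \<bullet> Q) + (1 + 2 * \<epsilon>) * (1 + 1 / \<epsilon>) * (h \<bullet> h))"
    by simp
  have "0 \<le> \<nu>" using eps by (simp add: \<nu>)
  from mult_left_mono[OF energy this]
  have **: "\<nu> * (\<mu> * (Q \<bullet> Q)) \<le> \<nu> * (d2 + \<epsilon> / 2 * d3 + B + (1 / \<epsilon> + 1 + \<epsilon>) * (h \<bullet> h))" .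
  show ?thesis using * ** eps unfolding K by (simp add: algebra_simps add_divide_distrib)
qed

section \<open>The exponent and the admissible perturbation\<close>

text \<open>
  The quadratic condition on \<open>s\<close> holds strictly between \<open>p\<close> and \<open>p + sqrt (p (p - 1))\<close>, so by density
  it suffices that the dimension condition is strict at the right end point. With \<open>r = sqrt (p / (p - 1))\<close>
  that condition is \<open>N < 2 + 4 r\<^sup>2 + 4 r\<close>, or \<open>N - 1 < (2 r + 1)\<^sup>2\<close>. It is automatic for
  \<open>N \<le> 10\<close> since \<open>r > 1\<close>. For larger \<open>N\<close>, with \<open>k = sqrt (N - 1)\<close>, both the numerator and the
  denominator of the Joseph--Lundgren exponent contain \<open>(k - 1) (k + 3)\<close>, and the exponent reduces to
  \<open>(k - 1)\<^sup>2 / ((k + 1) (k - 3))\<close>; being below it means exactly \<open>k - 1 < 2 r\<close>.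
\<close>
lemma exists_farina_exponent:
  fixes p :: real
  assumes "(3 \<le> N \<and> N \<le> 10 \<and> 1 < p) \<or> (11 \<le> N \<and> 1 < p \<and> ereal p < joseph_lundgren_exponent N)"
  shows "\<exists>s. 1 \<le> s \<and> s\<^sup>2 < p * (2 * s - 1) \<and> real N < 2 + 4 * s / (p - 1)"
proof -
  define r where "r = sqrt (p / (p - 1))"
  have p: "1 < p" using assms by auto
  have r2: "r\<^sup>2 = p / (p - 1)" using p by (simp add: r_def)
  have "1 < p / (p - 1)" using p by (simp add: field_simps)
  then have r1: "1 < r" unfolding r_def by simp
  have pr: "p = (p - 1) * r\<^sup>2" using p by (simp add: r2)
  have main: "real N < 2 + 4 * r\<^sup>2 + 4 * r"
  proof (cases "N \<le> 10")
    case True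
    have "1 < r\<^sup>2" using r1 by (simp add: one_less_power)
    with True r1 show ?thesis by linarith
  next
    case False
    define k where "k = sqrt (real N - 1)"
    have N: "real N = k\<^sup>2 + 1" using False by (simp add: k_def)
    have k3: "3 < k" using False unfolding k_def by (intro real_less_rsqrt) auto
    have jl: "p < ((real N - 2)\<^sup>2 - 4 * real N + 8 * k) / ((real N - 2) * (real N - 10))"
      using assms False by (simp add: joseph_lundgren_exponent_def k_def)
    have e1: "(real N - 2)\<^sup>2 - 4 * real N + 8 * k = ((k - 1) * (k + 3)) * (k - 1)\<^sup>2"
      unfolding N by (simp add: power2_eq_square algebra_simps)
    have e2: "(real N - 2) * (real N - 10) = ((k - 1) * (k + 3)) * ((k + 1) * (k - 3))"
      unfolding N by (simp add: power2_eq_square algebra_simps)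
    have "p < (k - 1)\<^sup>2 / ((k + 1) * (k - 3))"
      using jl k3 unfolding e1 e2 by (subst (asm) mult_divide_mult_cancel_left) auto
    then have A: "p * ((k + 1) * (k - 3)) < (k - 1)\<^sup>2" using k3 by (simp add: pos_less_divide_eq)
    have "(k - 1)\<^sup>2 < (2 * r)\<^sup>2"
    proof -
      have "(k - 1)\<^sup>2 * (p - 1) < 4 * p" using A by (simp add: power2_eq_square algebra_simps)
      then have "(k - 1)\<^sup>2 < 4 * p / (p - 1)" using p by (simp add: pos_less_divide_eq)
      then show ?thesis by (simp add: power_mult_distrib r2)
    qed
    then have "k - 1 < 2 * r" by (rule power_less_imp_less_base) (use r1 in auto)
    then have "k\<^sup>2 < (2 * r + 1)\<^sup>2" using k3 by (intro power_strict_mono) auto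
    then show ?thesis unfolding N by (simp add: power2_eq_square algebra_simps)
  qed
  define smax where "smax = p + (p - 1) * r"
  have "(p - 1) * (real N - 2) / 4 < smax"
  proof -
    have "(p - 1) * (real N - 2) < (p - 1) * (4 * r\<^sup>2 + 4 * r)"
      using main p by (intro mult_strict_left_mono) auto
    also have "\<dots> = 4 * smax" unfolding smax_def using pr by (simp add: algebra_simps)
    finally show ?thesis by simp
  qed
  moreover have "p < smax" using p r1 by (simp add: smax_def)
  ultimately obtain s where s: "max p ((p - 1) * (real N - 2) / 4) < s" "s < smax"
    using dense[of "max p ((p - 1) * (real N - 2) / 4)" smax] by auto
  \<comment> \<open>\<open>s\<^sup>2 < p (2 s - 1)\<close> is \<open>(s - p)\<^sup>2 < p\<^sup>2 - p\<close>, and the right side is \<open>((p - 1) r)\<^sup>2\<close>.\<close>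
  have "(s - p)\<^sup>2 < ((p - 1) * r)\<^sup>2"
    using s by (intro power_strict_mono) (auto simp: smax_def)
  also have "\<dots> = (p - 1) * ((p - 1) * r\<^sup>2)" by (simp add: power2_eq_square algebra_simps)
  also have "\<dots> = p\<^sup>2 - p" unfolding pr[symmetric] by (simp add: power2_eq_square algebra_simps)
  finally have "s\<^sup>2 < p * (2 * s - 1)" by (simp add: power2_eq_square algebra_simps)
  moreover have "real N < 2 + 4 * s / (p - 1)" using s p by (simp add: field_simps)
  ultimately show ?thesis using s p by (intro exI[of _ s]) auto
qed

text \<open>
  At \<open>\<epsilon> = 0\<close> the two strict inequalities are \<open>0 < 2 s - 1\<close> and \<open>s\<^sup>2 < p (2 s - 1)\<close>; they
  persist for small \<open>\<epsilon>\<close> by continuity. The size of \<open>\<epsilon>\<close> decides how much advection is allowed.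
\<close>
lemma exists_perturbation:
  fixes s p :: real
  assumes "1 \<le> s" "s\<^sup>2 < p * (2 * s - 1)"
  shows "\<exists>\<epsilon>. 0 < \<epsilon> \<and> \<epsilon> \<le> 1 \<and> 0 < 2 * s - 1 - 2 * \<epsilon> - \<epsilon> * (1 + \<epsilon>) * s\<^sup>2 \<and>
    (1 + 2 * \<epsilon>) * (1 + \<epsilon>) * s\<^sup>2 < (2 * s - 1 - 2 * \<epsilon> - \<epsilon> * (1 + \<epsilon>) * s\<^sup>2) * p"
proof -
  let ?m = "\<lambda>\<epsilon>. 2 * s - 1 - 2 * \<epsilon> - \<epsilon> * (1 + \<epsilon>) * s\<^sup>2"
  have "(?m \<longlongrightarrow> 2 * s - 1 - 2 * 0 - 0 * (1 + 0) * s\<^sup>2) (at_right 0)"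
    by (intro tendsto_intros)
  then have 1: "\<forall>\<^sub>F \<epsilon> in at_right 0. 0 < ?m \<epsilon>"
    by (rule order_tendstoD(1)) (use assms in auto)
  have "((\<lambda>\<epsilon>. ?m \<epsilon> * p - (1 + 2 * \<epsilon>) * (1 + \<epsilon>) * s\<^sup>2) \<longlongrightarrow>
     (2 * s - 1 - 2 * 0 - 0 * (1 + 0) * s\<^sup>2) * p - (1 + 2 * 0) * (1 + 0) * s\<^sup>2) (at_right 0)"
    by (intro tendsto_intros)
  then have 2: "\<forall>\<^sub>F \<epsilon> in at_right 0. 0 < ?m \<epsilon> * p - (1 + 2 * \<epsilon>) * (1 + \<epsilon>) * s\<^sup>2"
    by (rule order_tendstoD(1)) (use assms in \<open>auto simp: mult.commute\<close>)
  have 3: "\<forall>\<^sub>F \<epsilon> in at_right (0::real). \<epsilon> < 1" "\<forall>\<^sub>F \<epsilon> in at_right (0::real). 0 < \<epsilon>"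
    using order_tendstoD(2)[OF tendsto_ident_at, of 0 1 "{0::real<..}"] eventually_at_right_less[of "0::real"]
    by simp_all
  from 1 2 3 have "\<forall>\<^sub>F \<epsilon> in at_right 0. 0 < ?m \<epsilon> \<and> 0 < ?m \<epsilon> * p - (1 + 2 * \<epsilon>) * (1 + \<epsilon>) * s\<^sup>2 \<and> \<epsilon> < 1 \<and> 0 < \<epsilon>"
    by eventually_elim auto
  then obtain \<epsilon> where "0 < ?m \<epsilon> \<and> 0 < ?m \<epsilon> * p - (1 + 2 * \<epsilon>) * (1 + \<epsilon>) * s\<^sup>2 \<and> \<epsilon> < 1 \<and> 0 < \<epsilon>"
    using eventually_happens'[OF trivial_limit_at_right_real] by blast
  then show ?thesis by (intro exI[of _ \<epsilon>]) auto
qed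

section \<open>The energy estimate for stable solutions\<close>

lemma smooth_on_partial_deriv:
  "smooth_on S f \<Longrightarrow> smooth_on S (partial_deriv i f)"
  unfolding smooth_on_def by (metis Ck_on.simps(2))

lemma smooth_imp_C1_along:
  fixes f :: "real^'n::finite \<Rightarrow> real"
  assumes "smooth_on UNIV f"
  shows "C1_along (axis i 1) f (partial_deriv i f)"
proof -
  have "Ck_on (Suc 0) UNIV f" "Ck_on 0 UNIV f" using assms unfolding smooth_on_def by blast+
  then have d: "f differentiable_on UNIV" and c: "continuous_on UNIV (partial_deriv i f)" "continuous_on UNIV f"
    by auto
  have "((\<lambda>t. f (x + t *\<^sub>R axis i 1)) has_real_derivative partial_deriv i f x) (at 0)" for x
  proof -
    have fx: "(f has_derivative frechet_derivative f (at x)) (at (x + 0 *\<^sub>R axis i 1))"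
      using d by (simp add: differentiable_on_def frechet_derivative_works)
    then have lin: "linear (frechet_derivative f (at x))" by (auto dest: has_derivative_linear)
    have "((\<lambda>t. x + t *\<^sub>R axis i 1) has_derivative (\<lambda>h. h *\<^sub>R axis i 1)) (at (0::real))"
      by (auto intro!: derivative_eq_intros)
    from has_derivative_compose[OF this fx]
    show ?thesis
      by (simp add: has_field_derivative_def partial_deriv_def linear_cmul[OF lin] mult_commute_abs)
  qed
  with c show ?thesis by (simp add: C1_along_def)
qed

lemma sum_inner_axis_squared:
  fixes x :: "real^'n::finite"
  shows "(\<Sum>i\<in>UNIV. (x \<bullet> axis i 1)\<^sup>2) = x \<bullet> x"
  by (simp only: inner_axis) (simp add: inner_vec_def power2_eq_square)

text \<open>
  \<open>W\<close> is the divergence of a combination of the three compactly supported fields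
  \<open>\<psi>\<^sup>2 \<nabla>E / E\<close> (stability), \<open>\<theta>\<^sup>2 u\<^sup>2\<^sup>s\<^sup>-\<^sup>1 \<nabla>u\<close> (the equation tested with a power of \<open>u\<close>) and
  \<open>\<psi>\<^sup>2 x / (1 + x \<bullet> x)\<close> (Hardy's inequality), with \<open>\<psi> = u\<^sup>s \<theta>\<close>. Carrying the
  divergence as an explicit pointwise term postpones all integration to a single step. The dimension
  enters through the last field: \<open>x / (1 + x \<bullet> x)\<close> has divergence at least \<open>1 / (1 + x \<bullet> x)\<close>
  as soon as \<open>N \<ge> 3\<close>.
\<close>
lemma stable_energy_estimate:
  fixes u E \<theta> :: "real^'n::finite \<Rightarrow> real" and a :: "real^'n \<Rightarrow> real^'n" and \<theta>' :: "'n \<Rightarrow> real^'n \<Rightarrow> real"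
  assumes N: "3 \<le> CARD('n)"
    and u: "smooth_on UNIV u" "\<And>x. 0 < u x" "\<And>x. advection_op a u x = u x powr p"
    and E: "smooth_on UNIV E" "\<And>x. 0 < E x" "\<And>x. p * u x powr (p - 1) * E x \<le> advection_op a E x"
    and a: "\<And>x. norm (a x) \<le> C / (norm x + 1)"
    and \<theta>: "\<And>i. C1_along (axis i 1) \<theta> (\<theta>' i)" "\<And>x. R < norm x \<Longrightarrow> \<theta> x = 0"
    and eps: "0 < \<epsilon>" "\<epsilon> \<le> 1" and C: "0 \<le> C" "C \<le> \<epsilon> / 2"
    and \<mu>: "\<mu> = 2 * s - 1 - 2 * \<epsilon> - \<epsilon> * (1 + \<epsilon>) * s\<^sup>2" "0 < \<mu>"
    and \<nu>: "\<nu> = (1 + 2 * \<epsilon>) * (1 + \<epsilon>) * s\<^sup>2"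
    and K: "K = \<mu> * (1 + 2 * \<epsilon>) * (1 + 1 / \<epsilon>) + \<nu> * (1 / \<epsilon> + 1 + \<epsilon>)"
  shows "\<exists>W. integrable lborel W \<and> integral\<^sup>L lborel W = 0 \<and>
    (\<forall>x. (\<mu> * p - \<nu>) * (u x powr (2 * s + p - 1) * (\<theta> x)\<^sup>2)
        \<le> W x + K * (u x powr (2 * s) * (\<Sum>i\<in>UNIV. (\<theta>' i x)\<^sup>2)))"
proof -
  let ?e = "\<lambda>i::'n. axis i (1::real)"
  define u' where "u' i = partial_deriv i u" for i
  define u'' where "u'' i = partial_deriv i (partial_deriv i u)" for i
  define E' where "E' i = partial_deriv i E" for i
  define E'' where "E'' i = partial_deriv i (partial_deriv i E)" for i
  have Cu: "C1_along (?e i) u (u' i)" and Cu': "C1_along (?e i) (u' i) (u'' i)"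
    and CE: "C1_along (?e i) E (E' i)" and CE': "C1_along (?e i) (E' i) (E'' i)" for i
    unfolding u'_def u''_def E'_def E''_def
    by (intro smooth_imp_C1_along smooth_on_partial_deriv u E)+
  define \<psi> where "\<psi> x = u x powr s * \<theta> x" for x
  define \<psi>' where "\<psi>' i x = s * u x powr (s - 1) * u' i x * \<theta> x + u x powr s * \<theta>' i x" for i x
  have C\<psi>: "C1_along (?e i) \<psi> (\<psi>' i)" for i
    unfolding \<psi>_def \<psi>'_def by (rule C1_along_mult[OF C1_along_powr[OF Cu u(2)] \<theta>(1)])
  define F where "F i x = E' i x * inverse (E x)" for i x
  define F' where "F' i x = E'' i x * inverse (E x) + E' i x * (- E' i x * (inverse (E x))\<^sup>2)" for i x
  have CF: "C1_along (?e i) (F i) (F' i)" for i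
    unfolding F_def F'_def by (rule C1_along_mult[OF CE' C1_along_inverse[OF CE E(2)]])
  define w where "w x = inverse (1 + x \<bullet> x)" for x :: "real^'n"
  define w' where "w' i x = - (0 + 2 * (x \<bullet> ?e i)) * (inverse (1 + x \<bullet> x))\<^sup>2" for i and x :: "real^'n"
  have Cw: "C1_along (?e i) w (w' i)" for i
    unfolding w_def w'_def
    by (rule C1_along_inverse[OF C1_along_add[OF C1_along_const C1_along_norm_sq]])
      (simp add: add_pos_nonneg)
  define X where "X i x = (x \<bullet> ?e i) * w x" for i x
  define X' where "X' i x = (?e i \<bullet> ?e i) * w x + (x \<bullet> ?e i) * w' i x" for i x
  have CX: "C1_along (?e i) (X i) (X' i)" for i
    unfolding X_def X'_def by (rule C1_along_mult[OF C1_along_inner Cw])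
  define V1' where "V1' i x = (\<psi>' i x * \<psi> x + \<psi> x * \<psi>' i x) * F i x + \<psi> x * \<psi> x * F' i x" for i x
  have CV1: "C1_along (?e i) (\<lambda>x. \<psi> x * \<psi> x * F i x) (V1' i)" for i
    unfolding V1'_def by (rule C1_along_mult[OF C1_along_mult[OF C\<psi> C\<psi>] CF])
  define V3' where "V3' i x = (\<psi>' i x * \<psi> x + \<psi> x * \<psi>' i x) * X i x + \<psi> x * \<psi> x * X' i x" for i x
  have CV3: "C1_along (?e i) (\<lambda>x. \<psi> x * \<psi> x * X i x) (V3' i)" for i
    unfolding V3'_def by (rule C1_along_mult[OF C1_along_mult[OF C\<psi> C\<psi>] CX])
  define V2' where "V2' i x = (\<theta>' i x * \<theta> x + \<theta> x * \<theta>' i x) * (u x powr (2 * s - 1) * u' i x) +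
     \<theta> x * \<theta> x * ((2 * s - 1) * u x powr (2 * s - 1 - 1) * u' i x * u' i x + u x powr (2 * s - 1) * u'' i x)" for i x
  have CV2: "C1_along (?e i) (\<lambda>x. \<theta> x * \<theta> x * (u x powr (2 * s - 1) * u' i x)) (V2' i)" for i
    unfolding V2'_def
    by (rule C1_along_mult[OF C1_along_mult[OF \<theta>(1) \<theta>(1)] C1_along_mult[OF C1_along_powr[OF Cu u(2)] Cu']])
  define W where "W i x = (- \<mu>) * V1' i x + (\<nu> * V2' i x + \<epsilon> / 2 * (\<mu> + \<nu>) * V3' i x)" for i x
  have CW: "C1_along (?e i) (\<lambda>x. (- \<mu>) * (\<psi> x * \<psi> x * F i x) + (\<nu> * (\<theta> x * \<theta> x * (u x powr (2 * s - 1) * u' i x))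
      + \<epsilon> / 2 * (\<mu> + \<nu>) * (\<psi> x * \<psi> x * X i x))) (W i)" for i
    unfolding W_def
    by (rule C1_along_add[OF C1_along_cmult[OF CV1] C1_along_add[OF C1_along_cmult[OF CV2] C1_along_cmult[OF CV3]]])
  have intW: "integrable lborel (W i)" "integral\<^sup>L lborel (W i) = 0" for i
    using integral_derivative_along_zero[OF CW[of i], of R] \<theta>(2) by (auto simp: \<psi>_def)
  have pw: "(\<mu> * p - \<nu>) * (u x powr (2 * s + p - 1) * (\<theta> x)\<^sup>2)
        \<le> (\<Sum>i\<in>UNIV. W i x) + K * (u x powr (2 * s) * (\<Sum>i\<in>UNIV. (\<theta>' i x)\<^sup>2))" for x
  proof -
    define Pv where "Pv = (\<chi> i. \<psi>' i x)"
    define Fv where "Fv = (\<chi> i. F i x)"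
    define Xv where "Xv = (\<chi> i. X i x)"
    define Qv where "Qv = (\<chi> i. u x powr (s - 1) * \<theta> x * u' i x)"
    define hv where "hv = (\<chi> i. u x powr s * \<theta>' i x)"
    define B where "B = u x powr (2 * s + p - 1) * (\<theta> x)\<^sup>2"
    have ux: "0 < u x" and Ex: "0 < E x" by (rule u E)+
    have pw1: "u x powr (2 * s - 1 - 1) = u x powr (s - 1) * u x powr (s - 1)"
      "u x powr (2 * s - 1) = u x powr (s - 1) * u x powr s"
      "u x powr (2 * s) = u x powr s * u x powr s"
      by (simp_all add: powr_add[symmetric] algebra_simps)
    have pw2: "u x powr (2 * s + p - 1) = u x powr (2 * s - 1) * u x powr p"
      "u x powr (2 * s + p - 1) = u x powr (2 * s) * u x powr (p - 1)"
      by (simp_all add: powr_add[symmetric] algebra_simps)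
    have w_pos: "0 < w x" unfolding w_def by (simp add: add_pos_nonneg)
    have xw: "(x \<bullet> x) * w x \<le> 1"
      unfolding w_def by (simp add: divide_inverse[symmetric] divide_le_eq add_pos_nonneg)
    have Xv: "Xv \<bullet> Xv = (x \<bullet> x) * w x * w x"
    proof -
      have "Xv \<bullet> Xv = (\<Sum>i\<in>UNIV. X i x * X i x)" by (simp add: Xv_def inner_vec_def)
      also have "\<dots> = (\<Sum>i\<in>UNIV. (x \<bullet> ?e i)\<^sup>2 * (w x * w x))"
        by (simp add: X_def power2_eq_square mult_ac)
      also have "\<dots> = (x \<bullet> x) * w x * w x" by (simp only: sum_distrib_right[symmetric] sum_inner_axis_squared mult.assoc)
      finally show ?thesis .
    qed
    have XX: "Xv \<bullet> Xv \<le> w x"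
      unfolding Xv using mult_right_mono[OF xw, of "w x"] w_pos by simp
    have aa: "(norm (a x))\<^sup>2 \<le> C\<^sup>2 * w x"
    proof -
      have "(norm (a x))\<^sup>2 \<le> (C / (norm x + 1))\<^sup>2" by (rule power_mono[OF a]) simp
      also have "\<dots> = C\<^sup>2 * inverse ((norm x + 1)\<^sup>2)" by (simp add: divide_inverse power_mult_distrib power_inverse)
      also have "\<dots> \<le> C\<^sup>2 * w x"
        unfolding w_def
        by (intro mult_left_mono le_imp_inverse_le)
          (auto simp: power2_norm_eq_inner[symmetric] add_pos_nonneg power2_sum)
      finally show ?thesis .
    qed
    have lapE: "laplacian E x = (\<Sum>i\<in>UNIV. E'' i x)" and lapu: "laplacian u x = (\<Sum>i\<in>UNIV. u'' i x)"
      by (simp_all add: laplacian_def E''_def u''_def)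
    have gradE: "a x \<bullet> gradient E x = (\<Sum>i\<in>UNIV. a x $ i * E' i x)" and gradu: "a x \<bullet> gradient u x = (\<Sum>i\<in>UNIV. a x $ i * u' i x)"
      by (simp_all add: gradient_def inner_vec_def E'_def u'_def)
    have d1: "(\<Sum>i\<in>UNIV. V1' i x) \<le> 2 * \<psi> x * (Pv \<bullet> Fv) - (\<psi> x)\<^sup>2 * (Fv \<bullet> Fv) + (\<psi> x)\<^sup>2 * (a x \<bullet> Fv) - p * B"
    proof -
      have "V1' i x = 2 * \<psi> x * (\<psi>' i x * F i x) + (\<psi> x)\<^sup>2 * (inverse (E x) * E'' i x) - (\<psi> x)\<^sup>2 * (F i x * F i x)" for i
        by (simp add: V1'_def F'_def F_def power2_eq_square algebra_simps)
      then have *: "(\<Sum>i\<in>UNIV. V1' i x) = 2 * \<psi> x * (Pv \<bullet> Fv) + (\<psi> x)\<^sup>2 * (inverse (E x) * laplacian E x) - (\<psi> x)\<^sup>2 * (Fv \<bullet> Fv)"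
        by (simp add: Pv_def Fv_def inner_vec_def lapE sum.distrib sum_subtractf sum_distrib_left)
      have "laplacian E x \<le> a x \<bullet> gradient E x - p * u x powr (p - 1) * E x"
        using E(3)[of x] by (simp add: advection_op_def)
      then have "inverse (E x) * laplacian E x \<le> inverse (E x) * (a x \<bullet> gradient E x - p * u x powr (p - 1) * E x)"
        using Ex by (intro mult_left_mono) auto
      also have "\<dots> = inverse (E x) * (a x \<bullet> gradient E x) - p * u x powr (p - 1)"
        using Ex by (simp add: field_simps)
      also have "inverse (E x) * (a x \<bullet> gradient E x) = a x \<bullet> Fv"
        unfolding gradE by (simp add: Fv_def F_def inner_vec_def sum_distrib_left mult_ac)
      finally have "(\<psi> x)\<^sup>2 * (inverse (E x) * laplacian E x) \<le> (\<psi> x)\<^sup>2 * (a x \<bullet> Fv - p * u x powr (p - 1))"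
        by (intro mult_left_mono) auto
      also have "\<dots> = (\<psi> x)\<^sup>2 * (a x \<bullet> Fv) - p * B"
        unfolding B_def pw2(2) pw1(3) \<psi>_def by (simp add: power2_eq_square algebra_simps)
      finally show ?thesis unfolding * by linarith
    qed
    have d2: "(\<Sum>i\<in>UNIV. V2' i x) = (2 * s - 1) * (Qv \<bullet> Qv) + 2 * (Qv \<bullet> hv) + \<psi> x * (a x \<bullet> Qv) - B"
    proof -
      have "V2' i x = (2 * s - 1) * (Qv $ i * Qv $ i) + 2 * (Qv $ i * hv $ i) + u x powr (2 * s - 1) * (\<theta> x)\<^sup>2 * u'' i x" for i
        unfolding V2'_def pw1(1,2) by (simp add: Qv_def hv_def power2_eq_square algebra_simps)
      then have *: "(\<Sum>i\<in>UNIV. V2' i x) = (2 * s - 1) * (Qv \<bullet> Qv) + 2 * (Qv \<bullet> hv) + u x powr (2 * s - 1) * (\<theta> x)\<^sup>2 * laplacian u x"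
        by (simp add: inner_vec_def lapu sum.distrib sum_distrib_left)
      have lu: "laplacian u x = a x \<bullet> gradient u x - u x powr p"
        using u(3)[of x] by (simp add: advection_op_def)
      have "u x powr (2 * s - 1) * (\<theta> x)\<^sup>2 * (a x \<bullet> gradient u x) = \<psi> x * (a x \<bullet> Qv)"
        unfolding pw1(2) gradu by (simp add: Qv_def \<psi>_def inner_vec_def sum_distrib_left power2_eq_square mult_ac)
      then show ?thesis unfolding * lu B_def pw2(1) by (simp add: algebra_simps)
    qed
    have d3: "2 * \<psi> x * (Pv \<bullet> Xv) + (\<psi> x)\<^sup>2 * w x \<le> (\<Sum>i\<in>UNIV. V3' i x)"
    proof -
      have "V3' i x = 2 * \<psi> x * (\<psi>' i x * X i x) + (\<psi> x)\<^sup>2 * (w x - 2 * ((x \<bullet> ?e i)\<^sup>2 * (w x * w x)))" for i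
        by (simp add: V3'_def X'_def w'_def w_def power2_eq_square algebra_simps)
      then have "(\<Sum>i\<in>UNIV. V3' i x) = 2 * \<psi> x * (Pv \<bullet> Xv) + (\<psi> x)\<^sup>2 * (\<Sum>i\<in>UNIV. w x - 2 * ((x \<bullet> ?e i)\<^sup>2 * (w x * w x)))"
        by (simp add: Pv_def Xv_def inner_vec_def sum.distrib sum_distrib_left)
      moreover have "(\<Sum>i\<in>UNIV. w x - 2 * ((x \<bullet> ?e i)\<^sup>2 * (w x * w x))) = real CARD('n) * w x - 2 * (Xv \<bullet> Xv)"
        by (simp only: sum_subtractf sum_distrib_left[symmetric] sum_distrib_right[symmetric] sum_inner_axis_squared Xv) (simp add: mult_ac)
      moreover have "w x \<le> real CARD('n) * w x - 2 * (Xv \<bullet> Xv)"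
      proof -
        have "3 * w x \<le> real CARD('n) * w x" using N w_pos by (intro mult_right_mono) auto
        with XX show ?thesis by linarith
      qed
      ultimately show ?thesis by (simp add: mult_left_mono)
    qed
    have P: "Pv = s *\<^sub>R Qv + hv"
      by (simp add: Pv_def Qv_def hv_def \<psi>'_def vec_eq_iff mult_ac)
    have hh: "hv \<bullet> hv = u x powr (2 * s) * (\<Sum>i\<in>UNIV. (\<theta>' i x)\<^sup>2)"
      unfolding pw1(3) by (simp add: hv_def inner_vec_def sum_distrib_left power2_eq_square mult_ac)
    have "(\<mu> * p - \<nu>) * B \<le> - \<mu> * (\<Sum>i\<in>UNIV. V1' i x) + \<nu> * (\<Sum>i\<in>UNIV. V2' i x) +
        \<epsilon> / 2 * (\<mu> + \<nu>) * (\<Sum>i\<in>UNIV. V3' i x) + K * (hv \<bullet> hv)"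
      by (rule farina_pointwise[OF eps C P aa XX \<mu> \<nu> K d1 d2 d3])
    also have "- \<mu> * (\<Sum>i\<in>UNIV. V1' i x) + \<nu> * (\<Sum>i\<in>UNIV. V2' i x) + \<epsilon> / 2 * (\<mu> + \<nu>) * (\<Sum>i\<in>UNIV. V3' i x) = (\<Sum>i\<in>UNIV. W i x)"
      unfolding W_def by (simp only: sum.distrib sum_distrib_left add.assoc)
    finally show ?thesis unfolding B_def hh .
  qed
  show ?thesis
  proof (intro exI[of _ "\<lambda>x. \<Sum>i\<in>UNIV. W i x"] conjI allI pw)
    show "integrable lborel (\<lambda>x. \<Sum>i\<in>UNIV. W i x)" using intW(1) by simp
    show "(\<integral>x. (\<Sum>i\<in>UNIV. W i x) \<partial>lborel) = 0" using intW by simp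
  qed
qed

section \<open>Cutoff functions and decay\<close>

text \<open>
  A form of Young's inequality that keeps track of the powers of the cutoff. Either
  \<open>L\<close> is dominated by \<open>\<delta> t\<^sup>p\<^sup>-\<^sup>1 \<eta>\<^sup>2\<close>, and the first term on the right suffices, or
  \<open>t\<^sup>p\<^sup>-\<^sup>1 \<eta>\<^sup>2\<close> is less than \<open>L / \<delta>\<close>, and raising this to the power \<open>2 s / (p - 1)\<close> bounds
  the left side, because \<open>\<eta> \<le> 1\<close> and \<open>m\<close> is large enough.
\<close>
lemma cutoff_absorption:
  fixes t \<eta> L \<delta> s p :: real
  assumes "0 < t" "0 \<le> \<eta>" "\<eta> \<le> 1" "0 < \<delta>" "0 < L" "1 < p" "0 < s" "2 * s / (p - 1) \<le> real m"
  shows "t powr (2 * s) * \<eta> ^ (2 * m) * L \<le> \<delta> * (t powr (2 * s + p - 1) * \<eta> ^ (2 * m + 2))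
           + (L / \<delta>) powr (2 * s / (p - 1)) * L"
proof (cases "L \<le> \<delta> * (t powr (p - 1) * \<eta>\<^sup>2)")
  case True
  have "t powr (2 * s) * \<eta> ^ (2 * m) * L \<le> t powr (2 * s) * \<eta> ^ (2 * m) * (\<delta> * (t powr (p - 1) * \<eta>\<^sup>2))"
    using True assms by (intro mult_left_mono) auto
  also have "\<dots> = \<delta> * (t powr (2 * s + p - 1) * \<eta> ^ (2 * m + 2))"
    by (simp add: powr_add[symmetric] power_add algebra_simps power2_eq_square)
  also have "\<dots> \<le> \<delta> * (t powr (2 * s + p - 1) * \<eta> ^ (2 * m + 2)) + (L / \<delta>) powr (2 * s / (p - 1)) * L"
    using assms by simp
  finally show ?thesis .
next
  case False
  let ?b = "2 * s / (p - 1)"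
  have b: "0 < ?b" using assms by simp
  have le: "t powr (p - 1) * \<eta>\<^sup>2 \<le> L / \<delta>" using False assms by (simp add: field_simps)
  have "t powr (2 * s) * \<eta> ^ (2 * m) \<le> (L / \<delta>) powr ?b"
  proof (cases "\<eta> = 0")
    case True
    then show ?thesis using assms b by (cases m) auto
  next
    case False
    then have \<eta>: "0 < \<eta>" using assms by simp
    have "\<eta> ^ (2 * m) = (\<eta>\<^sup>2) powr real m" using \<eta> by (simp add: powr_realpow power_mult)
    also have "\<dots> \<le> (\<eta>\<^sup>2) powr ?b"
      using \<eta> assms by (intro powr_mono') (auto simp: power_le_one)
    finally have "t powr (2 * s) * \<eta> ^ (2 * m) \<le> t powr (2 * s) * (\<eta>\<^sup>2) powr ?b"
      by (intro mult_left_mono) auto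
    also have "\<dots> = (t powr (p - 1) * \<eta>\<^sup>2) powr ?b"
      using assms \<eta> by (simp add: powr_mult powr_powr)
    also have "\<dots> \<le> (L / \<delta>) powr ?b"
      using le b assms by (intro powr_mono2) auto
    finally show ?thesis .
  qed
  then have "t powr (2 * s) * \<eta> ^ (2 * m) * L \<le> (L / \<delta>) powr ?b * L"
    using assms by (intro mult_right_mono) auto
  moreover have "0 \<le> \<delta> * (t powr (2 * s + p - 1) * \<eta> ^ (2 * m + 2))"
    using assms by (intro mult_nonneg_nonneg zero_le_power) auto
  ultimately show ?thesis by linarith
qed

text \<open>
  Powers of this function serve as cutoffs: from the square on they are continuously differentiable
  across the sphere of radius \<open>R\<close>, and their gradient is explicit and of order \<open>1 / R\<close>.
\<close>
definition paraboloid_cutoff :: "real \<Rightarrow> 'a::real_inner \<Rightarrow> real" where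
  "paraboloid_cutoff R x = max 0 (1 - (x \<bullet> x) / R\<^sup>2)"

lemma paraboloid_cutoff_bounds: "0 \<le> paraboloid_cutoff R x" "paraboloid_cutoff R x \<le> 1"
  by (auto simp: paraboloid_cutoff_def)

lemma paraboloid_cutoff_eq_0:
  assumes "0 < R" "R < norm x"
  shows "paraboloid_cutoff R x = 0"
proof -
  have "R\<^sup>2 < (norm x)\<^sup>2" using assms by (intro power_strict_mono) auto
  then show ?thesis using assms by (simp add: paraboloid_cutoff_def power2_norm_eq_inner)
qed

lemma C1_along_paraboloid_cutoff_power:
  "C1_along e (\<lambda>x. paraboloid_cutoff R x ^ Suc (Suc k))
     (\<lambda>x. real (Suc (Suc k)) * paraboloid_cutoff R x ^ Suc k * (- 2 * (x \<bullet> e) / R\<^sup>2))"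
proof -
  have "C1_along e (\<lambda>x. 1 + (- 1 / R\<^sup>2) * (x \<bullet> x)) (\<lambda>x. 0 + (- 1 / R\<^sup>2) * (2 * (x \<bullet> e)))"
    by (intro C1_along_add C1_along_const C1_along_cmult C1_along_norm_sq)
  from C1_along_max_zero_power[OF this, of k] show ?thesis
    by (simp add: paraboloid_cutoff_def del: power_Suc)
qed

lemma paraboloid_cutoff_power_gradient_bound:
  fixes x :: "real^'n::finite"
  assumes R: "0 < R"
  shows "(\<Sum>i\<in>UNIV. (real (Suc (Suc k)) * paraboloid_cutoff R x ^ Suc k * (- 2 * (x \<bullet> axis i 1) / R\<^sup>2))\<^sup>2)
    \<le> paraboloid_cutoff R x ^ (2 * Suc k) * (4 * (real (Suc (Suc k)))\<^sup>2 / R\<^sup>2)" (is "?lhs \<le> ?rhs")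
proof -
  let ?m = "real (Suc (Suc k))"
  let ?\<eta> = "paraboloid_cutoff R x"
  have "(?m * ?\<eta> ^ Suc k * (- 2 * (x \<bullet> axis i 1) / R\<^sup>2))\<^sup>2
      = ?m\<^sup>2 * ?\<eta> ^ (2 * Suc k) * 4 / R ^ 4 * (x \<bullet> axis i 1)\<^sup>2" for i
  proof -
    have "(?m * ?\<eta> ^ Suc k * (- 2 * (x \<bullet> axis i 1) / R\<^sup>2))\<^sup>2
        = ?m\<^sup>2 * (?\<eta> ^ Suc k)\<^sup>2 * (4 * (x \<bullet> axis i 1)\<^sup>2 / (R\<^sup>2)\<^sup>2)"
      unfolding power_mult_distrib power_divide by simp
    also have "(?\<eta> ^ Suc k)\<^sup>2 = ?\<eta> ^ (2 * Suc k)" by (metis power_even_eq)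
    also have "(R\<^sup>2)\<^sup>2 = R ^ 4" by simp
    finally show ?thesis by simp
  qed
  then have *: "?lhs = ?m\<^sup>2 * ?\<eta> ^ (2 * Suc k) * 4 / R ^ 4 * (x \<bullet> x)"
    by (simp only: sum_distrib_left[symmetric] sum_inner_axis_squared)
  show ?thesis
  proof (cases "R < norm x")
    case True
    then show ?thesis unfolding * by (simp add: paraboloid_cutoff_eq_0[OF R])
  next
    case False
    then have "(norm x)\<^sup>2 \<le> R\<^sup>2" by (intro power_mono) auto
    then have "?m\<^sup>2 * ?\<eta> ^ (2 * Suc k) * 4 / R ^ 4 * (x \<bullet> x) \<le> ?m\<^sup>2 * ?\<eta> ^ (2 * Suc k) * 4 / R ^ 4 * R\<^sup>2"
      by (intro mult_left_mono) (auto simp: power2_norm_eq_inner paraboloid_cutoff_bounds)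
    also have "\<dots> = ?rhs"
      using R by (simp add: power4_eq_xxxx power2_eq_square field_simps)
    finally show ?thesis unfolding * .
  qed
qed

text \<open>
  Take a power of the paraboloid cutoff in the energy estimate, absorb the main part of the gradient
  term into half of the left side by \<open>cutoff_absorption\<close>, and integrate. The left side is at least its value on the unit ball, which does
  not depend on \<open>R\<close>; the error is at most a multiple of \<open>R\<close> to the power \<open>- 2 - 4 s / (p - 1)\<close>
  times the volume of the ball of radius \<open>R\<close>.
\<close>
lemma stable_solution_decay:
  fixes u E :: "real^'n::finite \<Rightarrow> real" and a :: "real^'n \<Rightarrow> real^'n"
  assumes N: "3 \<le> CARD('n)" and p: "1 < p" and s: "1 \<le> s"
    and u: "smooth_on UNIV u" "\<And>x. 0 < u x" "\<And>x. advection_op a u x = u x powr p"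
    and E: "smooth_on UNIV E" "\<And>x. 0 < E x" "\<And>x. p * u x powr (p - 1) * E x \<le> advection_op a E x"
    and a: "\<And>x. norm (a x) \<le> C / (norm x + 1)"
    and eps: "0 < \<epsilon>" "\<epsilon> \<le> 1" and C: "0 \<le> C" "C \<le> \<epsilon> / 2"
    and \<mu>: "\<mu> = 2 * s - 1 - 2 * \<epsilon> - \<epsilon> * (1 + \<epsilon>) * s\<^sup>2" "0 < \<mu>"
    and \<nu>: "\<nu> = (1 + 2 * \<epsilon>) * (1 + \<epsilon>) * s\<^sup>2" and gap: "\<nu> < \<mu> * p"
  shows "\<exists>c M. 0 < c \<and> (\<forall>R\<ge>2. c \<le> M * R powr (real CARD('n) - (2 + 4 * s / (p - 1))))"
proof -
  define K where "K = \<mu> * (1 + 2 * \<epsilon>) * (1 + 1 / \<epsilon>) + \<nu> * (1 / \<epsilon> + 1 + \<epsilon>)"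
  have K0: "0 < K"
    unfolding K_def \<nu> using eps \<mu>(2) by (intro add_pos_nonneg mult_pos_pos) auto
  define g where "g = \<mu> * p - \<nu>"
  have g0: "0 < g" using gap by (simp add: g_def)
  \<comment> \<open>With this \<open>\<delta>\<close> the gradient term costs \<open>K \<delta> = g / 2\<close>, half of the coefficient on the left.\<close>
  define \<delta> where "\<delta> = g / (2 * K)"
  have \<delta>0: "0 < \<delta>" using g0 K0 by (simp add: \<delta>_def)
  define b where "b = 2 * s / (p - 1)"
  have b0: "0 < b" using s p by (simp add: b_def)
  \<comment> \<open>The power of the cutoff must be high enough for \<open>cutoff_absorption\<close>.\<close>
  obtain k where "b \<le> real k" using real_arch_simple by blast
  then have k: "b \<le> real (Suc k)" by simp
  define \<kappa> where "\<kappa> = 4 * (real (Suc (Suc k)))\<^sup>2"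
  have \<kappa>0: "0 < \<kappa>" by (simp add: \<kappa>_def)
  let ?B = "cball (0::real^'n) 1"
  have cu: "continuous_on UNIV u"
    using u(1) Ck_on.simps(1) unfolding smooth_on_def by blast
  have "continuous_on ?B (\<lambda>x. u x powr (2 * s + p - 1))"
    using u(2) by (intro continuous_intros continuous_on_subset[OF cu]) (auto simp: less_imp_neq[THEN not_sym])
  then have "\<exists>x0\<in>?B. \<forall>x\<in>?B. u x0 powr (2 * s + p - 1) \<le> u x powr (2 * s + p - 1)"
    by (intro continuous_attains_inf) auto
  then obtain x0 where x0: "\<And>x. x \<in> ?B \<Longrightarrow> u x0 powr (2 * s + p - 1) \<le> u x powr (2 * s + p - 1)"
    by blast
  define \<beta> where "\<beta> = u x0 powr (2 * s + p - 1) * (1 / 2) ^ (2 * Suc (Suc k))"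
  have \<beta>0: "0 < \<beta>" using u(2)[of x0] by (simp add: \<beta>_def)
  define \<omega> where "\<omega> = measure lborel ?B"
  have \<omega>0: "0 < \<omega>" unfolding \<omega>_def by simp
  have "g / 2 * \<beta> * \<omega> \<le> K * (\<kappa> / \<delta>) powr b * \<kappa> * \<omega> * R powr (real CARD('n) - (2 + 4 * s / (p - 1)))"
    if R: "2 \<le> R" for R
  proof -
    define \<eta> where "\<eta> = (paraboloid_cutoff R :: real^'n \<Rightarrow> real)"
    define \<theta>' where "\<theta>' = (\<lambda>i (x::real^'n). real (Suc (Suc k)) * \<eta> x ^ Suc k * (- 2 * (x \<bullet> axis i 1) / R\<^sup>2))"
    have R0: "0 < R" using R by simp
    have cut: "C1_along (axis i 1) (\<lambda>x. \<eta> x ^ Suc (Suc k)) (\<theta>' i)" for i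
      unfolding \<theta>'_def \<eta>_def by (rule C1_along_paraboloid_cutoff_power)
    have \<eta>0: "\<eta> x = 0" if "R < norm x" for x
      unfolding \<eta>_def by (rule paraboloid_cutoff_eq_0[OF R0 that])
    have \<eta>: "0 \<le> \<eta> x" "\<eta> x \<le> 1" for x unfolding \<eta>_def by (rule paraboloid_cutoff_bounds)+
    have grad: "(\<Sum>i\<in>UNIV. (\<theta>' i x)\<^sup>2) \<le> \<eta> x ^ (2 * Suc k) * (\<kappa> / R\<^sup>2)" for x
      unfolding \<theta>'_def \<eta>_def \<kappa>_def by (rule paraboloid_cutoff_power_gradient_bound[OF R0])
    define L where "L = \<kappa> / R\<^sup>2"
    have L0: "0 < L" using \<kappa>0 R0 by (simp add: L_def)
    have supp: "\<eta> x ^ Suc (Suc k) = 0" if "R < norm x" for x using \<eta>0[OF that] by simp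
    obtain W where W: "integrable lborel W" "integral\<^sup>L lborel W = 0"
      and est: "\<And>x. g * (u x powr (2 * s + p - 1) * (\<eta> x ^ Suc (Suc k))\<^sup>2)
        \<le> W x + K * (u x powr (2 * s) * (\<Sum>i\<in>UNIV. (\<theta>' i x)\<^sup>2))"
      using stable_energy_estimate[OF N u E a cut supp eps C \<mu> \<nu> K_def] unfolding g_def by blast
    have bound: "g / 2 * (u x powr (2 * s + p - 1) * \<eta> x ^ (2 * Suc (Suc k)))
        \<le> W x + K * ((L / \<delta>) powr b * L) * indicator (cball 0 R) x" for x
    proof (cases "R < norm x")
      case True
      then show ?thesis using est[of x] \<eta>0[OF True] by (simp add: \<theta>'_def)
    next
      case False
      have "u x powr (2 * s) * (\<Sum>i\<in>UNIV. (\<theta>' i x)\<^sup>2) \<le> u x powr (2 * s) * (\<eta> x ^ (2 * Suc k) * L)"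
        using grad[of x] by (intro mult_left_mono) (auto simp: L_def)
      also have "\<dots> = u x powr (2 * s) * \<eta> x ^ (2 * Suc k) * L" by simp
      also have "\<dots> \<le> \<delta> * (u x powr (2 * s + p - 1) * \<eta> x ^ (2 * Suc k + 2)) + (L / \<delta>) powr b * L"
        unfolding b_def
        by (rule cutoff_absorption) (use u(2) \<eta> \<delta>0 L0 p s k in \<open>auto simp: b_def\<close>)
      finally have "K * (u x powr (2 * s) * (\<Sum>i\<in>UNIV. (\<theta>' i x)\<^sup>2))
        \<le> K * (\<delta> * (u x powr (2 * s + p - 1) * \<eta> x ^ (2 * Suc k + 2)) + (L / \<delta>) powr b * L)"
        using K0 by (intro mult_left_mono) auto
      also have "\<dots> = g / 2 * (u x powr (2 * s + p - 1) * \<eta> x ^ (2 * Suc (Suc k))) + K * ((L / \<delta>) powr b * L)"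
        using K0 by (simp add: \<delta>_def algebra_simps)
      finally show ?thesis using est[of x] False
        by (simp add: power_mult[symmetric] mult.commute[of _ 2] del: power_Suc mult_Suc mult_Suc_right)
    qed
    have lower: "g / 2 * \<beta> * indicator ?B x \<le> g / 2 * (u x powr (2 * s + p - 1) * \<eta> x ^ (2 * Suc (Suc k)))" for x
    proof (cases "x \<in> ?B")
      case True
      have "x \<bullet> x \<le> 1" using True by (simp add: norm_eq_sqrt_inner)
      moreover have "4 \<le> R\<^sup>2" using power_mono[OF R, of 2] by simp
      ultimately have "(x \<bullet> x) / R\<^sup>2 \<le> 1 / 4" by (intro frac_le) auto
      then have "1 / 2 \<le> 1 - (x \<bullet> x) / R\<^sup>2" by linarith
      then have "1 / 2 \<le> \<eta> x" unfolding \<eta>_def paraboloid_cutoff_def by (rule max.coboundedI2)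
      then have "(1 / 2) ^ (2 * Suc (Suc k)) \<le> \<eta> x ^ (2 * Suc (Suc k))" by (intro power_mono) auto
      then have "\<beta> \<le> u x powr (2 * s + p - 1) * \<eta> x ^ (2 * Suc (Suc k))"
        unfolding \<beta>_def using x0[OF True] by (intro mult_mono) auto
      then show ?thesis using True g0 by (simp add: mult_left_mono)
    next
      case False
      then show ?thesis using g0 \<eta>(1)[of x] by simp
    qed
    have fin: "integrable lborel (indicator (cball (0::real^'n) r) :: real^'n \<Rightarrow> real)" for r
      using emeasure_bounded_finite[OF bounded_cball, of "0::real^'n" r] by (intro integrable_real_indicator) auto
    have "(\<integral>x. g / 2 * \<beta> * indicator ?B x \<partial>lborel) \<le> (\<integral>x. W x + K * ((L / \<delta>) powr b * L) * indicator (cball 0 R) x \<partial>lborel)"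
      using fin W(1) order_trans[OF lower bound] by (intro integral_mono) auto
    then have "g / 2 * \<beta> * \<omega> \<le> K * ((L / \<delta>) powr b * L) * measure lborel (cball (0::real^'n) R)"
      using fin W by (simp add: \<omega>_def)
    also have "measure lborel (cball (0::real^'n) R) = \<omega> * R powr real CARD('n)"
      using R0 unfolding \<omega>_def by (simp add: content_cball powr_realpow)
    also have "K * ((L / \<delta>) powr b * L) * (\<omega> * R powr real CARD('n)) =
        K * (\<kappa> / \<delta>) powr b * \<kappa> * \<omega> * R powr (real CARD('n) - (2 + 4 * s / (p - 1)))"
    proof -
      have L: "L = \<kappa> * R powr (- 2)" using R0 by (simp add: L_def powr_minus powr_realpow divide_inverse)
      have "(L / \<delta>) powr b = (\<kappa> / \<delta> * R powr (- 2)) powr b" by (simp add: L)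
      also have "\<dots> = (\<kappa> / \<delta>) powr b * R powr (- 2 * b)"
        using \<kappa>0 \<delta>0 by (subst powr_mult) (simp_all add: powr_powr)
      finally have "K * ((L / \<delta>) powr b * L) * (\<omega> * R powr real CARD('n)) =
          K * (\<kappa> / \<delta>) powr b * \<kappa> * \<omega> * (R powr (- 2 * b) * R powr (- 2) * R powr real CARD('n))"
        by (simp add: L)
      also have "R powr (- 2 * b) * R powr (- 2) * R powr real CARD('n) = R powr (real CARD('n) - (2 + 4 * s / (p - 1)))"
        by (simp add: powr_add[symmetric] b_def algebra_simps)
      finally show ?thesis .
    qed
    finally show ?thesis .
  qed
  moreover have "0 < g / 2 * \<beta> * \<omega>" using g0 \<beta>0 \<omega>0 by simp
  ultimately show ?thesis by blast
qed

section \<open>Nonexistence\<close>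

theorem theorem1:
  fixes p :: real
  assumes "(3 \<le> CARD('n::finite) \<and> CARD('n) \<le> 10 \<and> 1 < p) \<or>
           (11 \<le> CARD('n) \<and> 1 < p \<and> ereal p < joseph_lundgren_exponent CARD('n))"
  shows "\<exists>C\<^sub>0::real. 0 < C\<^sub>0 \<and>
           (\<forall>C. 0 < C \<and> C \<le> C\<^sub>0 \<longrightarrow>
             (\<forall>a::real^'n \<Rightarrow> real^'n.
                smooth_on UNIV a \<and> (\<forall>x. divergence a x = 0) \<and>
                (\<forall>x. norm (a x) \<le> C / (norm x + 1)) \<longrightarrow>
                \<not> (\<exists>u::real^'n \<Rightarrow> real. (\<forall>x. 0 < u x) \<and> stable_solution a p UNIV u)))"
proof -
  have N: "3 \<le> CARD('n)" and p: "1 < p" using assms by auto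
  obtain s where s: "1 \<le> s" "s\<^sup>2 < p * (2 * s - 1)" and dim: "real CARD('n) < 2 + 4 * s / (p - 1)"
    using exists_farina_exponent[OF assms] by blast
  obtain \<epsilon> where eps: "0 < \<epsilon>" "\<epsilon> \<le> 1" and \<mu>: "0 < 2 * s - 1 - 2 * \<epsilon> - \<epsilon> * (1 + \<epsilon>) * s\<^sup>2"
    and gap: "(1 + 2 * \<epsilon>) * (1 + \<epsilon>) * s\<^sup>2 < (2 * s - 1 - 2 * \<epsilon> - \<epsilon> * (1 + \<epsilon>) * s\<^sup>2) * p"
    using exists_perturbation[OF s] by blast
  have nonexistence: False
    if C: "0 < C" "C \<le> \<epsilon> / 2" and a: "\<And>x. norm (a x) \<le> C / (norm x + 1)"
      and u: "\<And>x. 0 < u x" and st: "stable_solution a p UNIV u" for C a and u :: "real^'n \<Rightarrow> real"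
  proof -
    have su: "smooth_on UNIV u" "\<And>x. advection_op a u x = u x powr p"
      using st by (auto simp: stable_solution_def nonneg_smooth_solution_def)
    obtain E where E: "smooth_on UNIV E" "\<And>x. 0 < E x" "\<And>x. p * u x powr (p - 1) * E x \<le> advection_op a E x"
      using st by (auto simp: stable_solution_def)
    obtain c M where c: "0 < c" and M: "\<And>R. 2 \<le> R \<Longrightarrow> c \<le> M * R powr (real CARD('n) - (2 + 4 * s / (p - 1)))"
      using stable_solution_decay[OF N p s(1) su(1) u su(2) E a eps less_imp_le[OF C(1)] C(2) refl \<mu> refl gap] by blast
    have "((\<lambda>R. M * R powr (real CARD('n) - (2 + 4 * s / (p - 1)))) \<longlongrightarrow> M * 0) at_top"
      using dim by (intro tendsto_mult tendsto_const tendsto_neg_powr filterlim_ident) auto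
    then have "\<forall>\<^sub>F R in at_top. M * R powr (real CARD('n) - (2 + 4 * s / (p - 1))) < c"
      by (rule order_tendstoD(2)) (use c in simp)
    moreover have "\<forall>\<^sub>F R in at_top. (2::real) \<le> R" by (rule eventually_ge_at_top)
    ultimately have "\<forall>\<^sub>F R in at_top. (2::real) \<le> R \<and> M * R powr (real CARD('n) - (2 + 4 * s / (p - 1))) < c"
      by eventually_elim auto
    then obtain R where "2 \<le> R" "M * R powr (real CARD('n) - (2 + 4 * s / (p - 1))) < c"
      using eventually_happens'[OF trivial_limit_at_top_linorder] by blast
    with M[of R] show False by linarith
  qed
  show ?thesis
  proof (intro exI[of _ "\<epsilon> / 2"] conjI allI impI notI)
    show "0 < \<epsilon> / 2" using eps by simp
    show False
      if "0 < C \<and> C \<le> \<epsilon> / 2"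
        and "smooth_on UNIV a \<and> (\<forall>x. divergence a x = 0) \<and> (\<forall>x. norm (a x) \<le> C / (norm x + 1))"
        and "\<exists>u. (\<forall>x. 0 < u x) \<and> stable_solution a p UNIV u" for C and a :: "real^'n \<Rightarrow> real^'n"
      using that nonexistence[of C a] by blast
  qed
qed

end
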